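(* Let $w$ be an edge path in an associahedron that starts at a vertex $D$, written as a word $w=\lceil v_1\rfloor\lceil v_2\rfloor\cdots\lceil v_k\rfloor$ in rotation symbols, and let $\Sigma(w)$ be its signed graph. Then (1) all of the endpoints of edges in $\Sigma(w)$ are internal vertices of $D$, and (2) there is a sign assignment for $D$ for which $w$ is valid if and only if $\Sigma(w)$ is balanced.
   Context: **Trees.** $\mathcal T$ is the infinite binary tree whose vertices are a root $*$ and all finite words over $\{0,1\}$ (including the empty word $\emptyset$). The only child of $*$ is $\emptyset$; the word $u$ has left child $u0$ and right child $u1$. A finite binary tree is a finite subtree of $\mathcal T$ containing $*$ and $\emptyset$, closed under taking prefixes, in which $u0$ is a vertex iff $u1$ is. Leaves are the vertices without children; internal vertices are the words in the tree that are not leaves. **Rotations.** For $u\in\{0,1\}^*$, the rotation $\lceil u\rfloor$ is the permutation of the vertices of $\mathcal T$ (acting on the right) given by $u00w\mapsto u0w$, $u01w\mapsto u10w$, $u1w\mapsto u11w$ for all $w\in\{0,1\}^*$, $u0\mapsto u$, $u\mapsto u1$, and fixing every other vertex. The symbol $\overline u$ is formal and $\lceil\overline u\rfloor=\lceil u\rfloor^{-1}$. The pivot vertices of $\lceil u\rfloor$ are $u$ and $u0$; the pivot vertices of $\lceil\overline u\rfloor$ are $u$ and $u1$. If both pivot vertices of a rotation $\lceil v\rfloor$ ($v=u$ or $v=\overline u$) are internal vertices of a finite binary tree $T$, then $\lceil v\rfloor$ applies to $T$, and $T\lceil v\rfloor$ is the finite binary tree whose vertex set is the image of that of $T$. **Associahedron.**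 The vertices of the $d$-dimensional associahedron $A_d$ are the finite binary trees with $d+2$ leaves; two are joined by an edge iff one is obtained from the other by a rotation. An edge path starting at $D$ is thus a word $w=\lceil v_1\rfloor\cdots\lceil v_k\rfloor$ (each $v_i$ of the form $u$ or $\overline u$) such that each $\lceil v_i\rfloor$ applies to $D\lceil v_1\rfloor\cdots\lceil v_{i-1}\rfloor$; its endpoint is $Dw$. **Sign assignments and validity.** A sign assignment on $T$ is a function $\sigma$ from the internal vertices of $T$ to $\{+,-\}$. A rotation $\lceil v\rfloor$ that applies to $T$ is valid for $(T,\sigma)$ if $\sigma$ gives equal signs to its two pivot vertices; the result is $T\lceil v\rfloor$ with the sign assignment $\rho$ where $\rho(x\lceil v\rfloor)=-\sigma(x)$ if $x$ is a pivot vertex of $\lceil v\rfloor$ and $\rho(x\lceil v\rfloor)=\sigma(x)$ for every other internal vertex $x$ of $T$. A path $w$ starting at $D$ is valid for a sign assignment on $D$ if its rotations, performed in succession, are each valid for the signed tree to which they are applied. **The signed graph $\Sigma(w)$.** Put $p_0=\mathrm{id}$ and $p_i=\lceil v_1\rfloor\cdots\lceil v_i\rfloor$ (permutation acting on the right, composed left to right). $\Sigma_0$ is the graph on the vertex set of $\mathcal T$ with no edges. Given $\Sigma_{i-1}$, the graph $\Sigma_i$ is obtained by adding one edge $e_i$ (parallel edges allowed) joining $s=(x)p_{i-1}^{-1}$ and $t=(y)p_{i-1}^{-1}$, where $x,y$ are the pivot vertices of $\lceil v_i\rfloor$; the edge $e_i$ is positive iff the sum of the degrees of $s$ and $t$ in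 $\Sigma_{i-1}$ is even, and negative otherwise. $\Sigma(w)=\Sigma_k$. A signed graph is balanced if every closed walk traverses an even number of negative edges. *)

theory Defs
  imports "HOL-Library.Sublist"
begin

section \<open>Finite binary trees\<close>

text \<open>
  Vertices of the infinite binary tree. A word over $\{0,1\}$ is a list read from left to right,
  with \<open>False\<close> for 0 and \<open>True\<close> for 1, so that the children of \<open>u\<close> extend \<open>u\<close> at its end.
\<close>

datatype vertex = Root | Word "bool list"

fun children :: "vertex \<Rightarrow> vertex set" where
  "children Root = {Word []}"
| "children (Word u) = {Word (u @ [False]), Word (u @ [True])}"

definition finite_binary_tree :: "vertex set \<Rightarrow> bool" where
  "finite_binary_tree T \<longleftrightarrow>
     finite T \<and> Root \<in> T \<and> Word [] \<in> T \<and>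
     (\<forall>u v. Word v \<in> T \<and> prefix u v \<longrightarrow> Word u \<in> T) \<and>
     (\<forall>u. Word (u @ [False]) \<in> T \<longleftrightarrow> Word (u @ [True]) \<in> T)"

definition leaves :: "vertex set \<Rightarrow> vertex set" where
  "leaves T = {x \<in> T. children x \<inter> T = {}}"

definition internal :: "vertex set \<Rightarrow> vertex set" where
  "internal T = {x \<in> T. x \<in> range Word \<and> x \<notin> leaves T}"

section \<open>Rotations\<close>

text \<open>The rotation at the empty word; the rotation at \<open>u\<close> acts by it below \<open>u\<close>.\<close>

fun rot_suffix :: "bool list \<Rightarrow> bool list" where
  "rot_suffix [] = [True]"
| "rot_suffix [False] = []"
| "rot_suffix (False # False # w) = False # w"
| "rot_suffix (False # True # w) = True # False # w"
| "rot_suffix (True # w) = True # True # w"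

fun rot :: "bool list \<Rightarrow> vertex \<Rightarrow> vertex" where
  "rot u Root = Root"
| "rot u (Word x) =
     (if prefix u x then Word (u @ rot_suffix (drop (length u) x)) else Word x)"

fun unrot_suffix :: "bool list \<Rightarrow> bool list" where
  "unrot_suffix [] = [False]"
| "unrot_suffix [True] = []"
| "unrot_suffix (False # w) = False # False # w"
| "unrot_suffix (True # False # w) = False # True # w"
| "unrot_suffix (True # True # w) = True # w"

lemma unrot_suffix_rot_suffix [simp]: "unrot_suffix (rot_suffix s) = s"
  by (induction s rule: rot_suffix.induct) auto

lemma rot_suffix_unrot_suffix [simp]: "rot_suffix (unrot_suffix s) = s"
  by (induction s rule: unrot_suffix.induct) auto

lemma bij_rot: "bij (rot u)"
proof (rule bijI)
  show "inj (rot u)"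
  proof (rule injI)
    fix x y assume "rot u x = rot u y"
    then show "x = y"
      by (cases x; cases y)
         (auto simp: prefix_def split: if_splits,
          metis unrot_suffix_rot_suffix)
  qed
  show "surj (rot u)"
  proof (rule surjI)
    fix y
    show "rot u (case y of Root \<Rightarrow> Root | Word x \<Rightarrow>
            if prefix u x then Word (u @ unrot_suffix (drop (length u) x)) else Word x) = y"
      by (cases y) (auto simp: prefix_def)
  qed
qed

text \<open>\<open>Rt u\<close> is the symbol \<open>u\<close>, and \<open>Lt u\<close> is the formal symbol written with a bar over \<open>u\<close>.\<close>

datatype symbol = Rt "bool list" | Lt "bool list"

fun rotation :: "symbol \<Rightarrow> vertex \<Rightarrow> vertex" where
  "rotation (Rt u) = rot u"
| "rotation (Lt u) = inv (rot u)"

lemma bij_rotation: "bij (rotation v)"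
  by (cases v) (simp_all add: bij_rot bij_imp_bij_inv)

fun pivot1 :: "symbol \<Rightarrow> vertex" where
  "pivot1 (Rt u) = Word u"
| "pivot1 (Lt u) = Word u"

fun pivot2 :: "symbol \<Rightarrow> vertex" where
  "pivot2 (Rt u) = Word (u @ [False])"
| "pivot2 (Lt u) = Word (u @ [True])"

definition applies :: "symbol \<Rightarrow> vertex set \<Rightarrow> bool" where
  "applies v T \<longleftrightarrow> pivot1 v \<in> internal T \<and> pivot2 v \<in> internal T"

definition rotate_tree :: "symbol \<Rightarrow> vertex set \<Rightarrow> vertex set" where
  "rotate_tree v T = rotation v ` T"

section \<open>Edge paths in the associahedron\<close>

definition associahedron_vertices :: "nat \<Rightarrow> vertex set set" where
  "associahedron_vertices d = {T. finite_binary_tree T \<and> card (leaves T) = d + 2}"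

text \<open>
  A rotation that applies to a vertex of the associahedron yields a vertex of the same
  associahedron, so a path is given by its starting tree and its word of rotation symbols.
\<close>

fun edge_path :: "vertex set \<Rightarrow> symbol list \<Rightarrow> bool" where
  "edge_path T [] \<longleftrightarrow> True"
| "edge_path T (v # vs) \<longleftrightarrow> applies v T \<and> edge_path (rotate_tree v T) vs"

section \<open>Sign assignments and validity\<close>

datatype sign = Plus | Minus

fun neg :: "sign \<Rightarrow> sign" where
  "neg Plus = Minus"
| "neg Minus = Plus"

definition sign_assignment :: "vertex set \<Rightarrow> (vertex \<rightharpoonup> sign) \<Rightarrow> bool" where
  "sign_assignment T \<sigma> \<longleftrightarrow> dom \<sigma> = internal T"

definition valid_rotation :: "symbol \<Rightarrow> vertex set \<Rightarrow> (vertex \<rightharpoonup> sign) \<Rightarrow> bool" where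
  "valid_rotation v T \<sigma> \<longleftrightarrow> applies v T \<and> \<sigma> (pivot1 v) = \<sigma> (pivot2 v)"

definition rotate_signs :: "symbol \<Rightarrow> (vertex \<rightharpoonup> sign) \<Rightarrow> (vertex \<rightharpoonup> sign)" where
  "rotate_signs v \<sigma> = (\<lambda>y. let x = inv (rotation v) y in
     if x = pivot1 v \<or> x = pivot2 v then map_option neg (\<sigma> x) else \<sigma> x)"

fun valid_path :: "vertex set \<Rightarrow> (vertex \<rightharpoonup> sign) \<Rightarrow> symbol list \<Rightarrow> bool" where
  "valid_path T \<sigma> [] \<longleftrightarrow> True"
| "valid_path T \<sigma> (v # vs) \<longleftrightarrow>
     valid_rotation v T \<sigma> \<and> valid_path (rotate_tree v T) (rotate_signs v \<sigma>) vs"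

section \<open>Signed graphs\<close>

text \<open>
  A finite signed multigraph whose vertex set is the whole type is given by the list of its edges;
  the edges are identified with the positions in the list, which allows parallel edges.
  The order of the two ends of an edge carries no meaning.
\<close>

datatype 'v signed_edge = SEdge (end1: 'v) (end2: 'v) (positive: bool)

type_synonym 'v signed_graph = "'v signed_edge list"

definition degree :: "'v signed_graph \<Rightarrow> 'v \<Rightarrow> nat" where
  "degree G x = (\<Sum>e\<leftarrow>G. of_bool (end1 e = x) + of_bool (end2 e = x))"

definition joins :: "'v signed_edge \<Rightarrow> 'v \<Rightarrow> 'v \<Rightarrow> bool" where
  "joins e x y \<longleftrightarrow> (end1 e = x \<and> end2 e = y) \<or> (end1 e = y \<and> end2 e = x)"

text \<open>\<open>walk G x is y\<close>: the edges at the positions \<open>is\<close> are traversed by a walk from \<open>x\<close> to \<open>y\<close>.\<close>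

fun walk :: "'v signed_graph \<Rightarrow> 'v \<Rightarrow> nat list \<Rightarrow> 'v \<Rightarrow> bool" where
  "walk G x [] y \<longleftrightarrow> x = y"
| "walk G x (i # is) y \<longleftrightarrow> i < length G \<and> (\<exists>z. joins (G ! i) x z \<and> walk G z is y)"

definition balanced :: "'v signed_graph \<Rightarrow> bool" where
  "balanced G \<longleftrightarrow>
     (\<forall>x is. walk G x is x \<longrightarrow> even (length (filter (\<lambda>i. \<not> positive (G ! i)) is)))"

section \<open>The signed graph of a word\<close>

text \<open>Permutations act on the right, so the first symbol of the word acts first.\<close>

fun word_perm :: "symbol list \<Rightarrow> vertex \<Rightarrow> vertex" where
  "word_perm [] x = x"
| "word_perm (v # vs) x = word_perm vs (rotation v x)"

lemma bij_word_perm: "bij (word_perm w)"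
proof (induction w)
  case Nil
  have "word_perm [] = id" by auto
  then show ?case by (metis bij_id)
next
  case (Cons v vs)
  have "word_perm (v # vs) = word_perm vs \<circ> rotation v" by auto
  then show ?case using Cons bij_rotation bij_comp by metis
qed

fun Sigma_upto :: "symbol list \<Rightarrow> nat \<Rightarrow> vertex signed_graph" where
  "Sigma_upto w 0 = []"
| "Sigma_upto w (Suc i) =
     (let G = Sigma_upto w i;
          p = word_perm (take i w);
          s = inv p (pivot1 (w ! i));
          t = inv p (pivot2 (w ! i))
      in G @ [SEdge s t (even (degree G s + degree G t))])"

definition Sigma_graph :: "symbol list \<Rightarrow> vertex signed_graph" where
  "Sigma_graph w = Sigma_upto w (length w)"

end

theory Submission
  imports Defs
begin

text \<open>
  A rotation carries the internal vertices of a tree onto those of the rotated tree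
  (\<open>internal_rotate_tree\<close>), so the permutation \<open>p\<^sub>i\<close> identifies
  the internal vertices of the \<open>i\<close>-th tree of the path with those of \<open>D\<close>; pulling the pivot
  vertices back along it gives the ends of the edges (\<open>Sigma_graph_ends_internal\<close>).

  Read in \<open>D\<close> through this identification, performing the \<open>i\<close>-th rotation flips exactly the signs
  of the two ends of the edge \<open>e\<^sub>i\<close>. Hence, after the first \<open>i\<close> rotations, the sign of \<open>x\<close> has been
  flipped as often as the degree of \<open>x\<close> in \<open>\<Sigma>\<^sub>i\<close> says (\<open>signs_after_path\<close>). The next rotation, with
  pulled-back pivots \<open>s\<close> and \<open>t\<close>, needs the current signs of \<open>s\<close> and \<open>t\<close> to be equal: the original
  signs must agree if the sum of the two degrees is even and differ if it is odd. The sign of the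
  edge was defined by just this parity, so \<open>w\<close> is valid for \<open>\<sigma>\<close> iff \<open>\<sigma>\<close> is constant along positive
  edges and changes along negative ones (\<open>valid_path_iff_consistent\<close>). By Harary's theorem
  (\<open>balanced_iff_consistent\<close>), such a two-colouring of a signed graph exists iff the graph is
  balanced.
\<close>

section \<open>Harary's balance theorem\<close>

definition consistent :: "('v \<Rightarrow> 'c) \<Rightarrow> 'v signed_graph \<Rightarrow> bool" where
  "consistent f G \<longleftrightarrow> (\<forall>e \<in> set G. f (end1 e) = f (end2 e) \<longleftrightarrow> positive e)"

definition negatives :: "'v signed_graph \<Rightarrow> nat list \<Rightarrow> nat" where
  "negatives G ps = length (filter (\<lambda>i. \<not> positive (G ! i)) ps)"

lemma negatives_simps [simp]:
  "negatives G [] = 0"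
  "negatives G (i # ps) = of_bool (\<not> positive (G ! i)) + negatives G ps"
  "negatives G (ps @ qs) = negatives G ps + negatives G qs"
  "negatives G (rev ps) = negatives G ps"
  by (simp_all add: negatives_def flip: rev_filter)

lemma joins_commute: "joins e x y \<longleftrightarrow> joins e y x"
  by (auto simp: joins_def)

lemma walk_append: "walk G x (ps @ qs) z \<longleftrightarrow> (\<exists>y. walk G x ps y \<and> walk G y qs z)"
  by (induction ps arbitrary: x) auto

lemma walk_rev: "walk G x ps y \<Longrightarrow> walk G y (rev ps) x"
  by (induction ps arbitrary: x) (auto simp: walk_append joins_commute)

lemma consistent_walk:
  fixes f :: "'v \<Rightarrow> bool"
  assumes "consistent f G" and "walk G x ps y"
  shows "f x = f y \<longleftrightarrow> even (negatives G ps)"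
  using assms(2)
proof (induction ps arbitrary: x)
  case (Cons i ps)
  then obtain z where i: "i < length G" "joins (G ! i) x z" and "walk G z ps y"
    by auto
  with Cons.IH have "f z = f y \<longleftrightarrow> even (negatives G ps)" by blast
  moreover have "f x = f z \<longleftrightarrow> positive (G ! i)"
    using i assms(1) nth_mem[OF i(1)] by (auto simp: consistent_def joins_def)
  ultimately show ?case by auto
qed simp

text \<open>
  For a balanced graph, choose a base vertex in each connected component and colour a vertex by
  the parity of the number of negative edges on a walk to it from the base vertex. Two such walks
  together form a closed walk, so by balance the parity does not depend on the walk.
\<close>

theorem balanced_iff_consistent:
  "balanced G \<longleftrightarrow> (\<exists>f :: 'v \<Rightarrow> bool. consistent f G)"
proof
  assume "\<exists>f :: 'v \<Rightarrow> bool. consistent f G"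
  then show "balanced G"
    by (metis balanced_def consistent_walk negatives_def)
next
  assume bal: "balanced G"
  define reach where "reach x = {y. \<exists>ps. walk G x ps y}" for x
  \<comment> \<open>The base vertex depends on the component only, because the choice is made from the set of
      its vertices.\<close>
  define base where "base x = (SOME y. y \<in> reach x)" for x
  define f where "f x \<longleftrightarrow> even (negatives G (SOME ps. walk G (base x) ps x))" for x
  have f: "f x \<longleftrightarrow> even (negatives G ps)" if "walk G (base x) ps x" for x ps
  proof -
    define qs where "qs = (SOME qs. walk G (base x) qs x)"
    have "walk G (base x) qs x" unfolding qs_def using that by (rule someI)
    then have "walk G (base x) (ps @ rev qs) (base x)"
      using that walk_rev walk_append by metis
    then have "even (negatives G (ps @ rev qs))"
      using bal unfolding balanced_def negatives_def by blast
    then show ?thesis by (simp add: f_def qs_def)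
  qed
  have reach_mono: "reach y \<subseteq> reach x" if "walk G x ps y" for x y ps
  proof
    fix z assume "z \<in> reach y"
    then obtain qs where "walk G y qs z" by (auto simp: reach_def)
    with that have "walk G x (ps @ qs) z" by (auto simp: walk_append)
    then show "z \<in> reach x" by (auto simp: reach_def)
  qed
  have "f (end1 e) = f (end2 e) \<longleftrightarrow> positive e" if "e \<in> set G" for e
  proof -
    from that obtain i where i: "i < length G" "e = G ! i" by (metis in_set_conv_nth)
    have e: "walk G (end1 e) [i] (end2 e)" using i by (simp add: joins_def)
    have "reach (end1 e) = reach (end2 e)"
      using reach_mono[OF e] reach_mono[OF walk_rev[OF e]] by blast
    then have base: "base (end2 e) = base (end1 e)" by (simp add: base_def)
    have "end1 e \<in> reach (end1 e)" by (auto simp: reach_def intro: exI[of _ "[]"])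
    then have "base (end1 e) \<in> reach (end1 e)" unfolding base_def by (rule someI)
    then obtain ps where "walk G (end1 e) ps (base (end1 e))" by (auto simp: reach_def)
    then have p: "walk G (base (end1 e)) (rev ps) (end1 e)" by (rule walk_rev)
    then have "walk G (base (end2 e)) (rev ps @ [i]) (end2 e)"
      using e by (auto simp: base walk_append simp del: walk.simps)
    from f[OF p] f[OF this] show ?thesis by (simp add: i)
  qed
  then show "\<exists>f :: 'v \<Rightarrow> bool. consistent f G" by (auto simp: consistent_def)
qed

section \<open>Rotations preserve finite binary trees and their internal vertices\<close>

lemma pivots_distinct: "pivot1 v \<noteq> pivot2 v"
  by (cases v) auto

lemma inv_rotation_rotation [simp]: "inv (rotation v) (rotation v x) = x"
  by (simp add: bij_rotation bij_is_inj)

lemma rotation_inv_rotation [simp]: "rotation v (inv (rotation v) x) = x"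
  by (simp add: bij_rotation bij_is_surj surj_f_inv_f)

lemma mem_rotate_tree: "y \<in> rotate_tree v T \<longleftrightarrow> inv (rotation v) y \<in> T"
proof
  assume "inv (rotation v) y \<in> T"
  then have "rotation v (inv (rotation v) y) \<in> rotate_tree v T"
    unfolding rotate_tree_def by (rule imageI)
  then show "y \<in> rotate_tree v T" by simp
qed (auto simp: rotate_tree_def)

fun preimage_word :: "symbol \<Rightarrow> bool list \<Rightarrow> bool list" where
  "preimage_word (Rt u) y = (if prefix u y then u @ unrot_suffix (drop (length u) y) else y)"
| "preimage_word (Lt u) y = (if prefix u y then u @ rot_suffix (drop (length u) y) else y)"

lemma inv_rotation_Word: "inv (rotation v) (Word y) = Word (preimage_word v y)"
proof (cases v)
  case (Rt u)
  have "rotation v (Word (preimage_word v y)) = Word y"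
    using Rt by (auto simp: prefix_def)
  then show ?thesis by (metis inv_rotation_rotation)
next
  case (Lt u)
  then show ?thesis by (simp add: inv_inv_eq bij_rot)
qed

lemma inv_rotation_Root: "inv (rotation v) Root = Root"
  by (cases v) (simp_all add: inv_inv_eq bij_rot inv_f_eq bij_is_inj)

lemma finite_binary_tree_parent:
  "finite_binary_tree T \<Longrightarrow> Word (y @ [b]) \<in> T \<Longrightarrow> Word y \<in> T"
  unfolding finite_binary_tree_def using prefixI[of "y @ [b]" y "[b]"] by blast

lemma finite_binary_tree_sibling:
  "finite_binary_tree T \<Longrightarrow> Word (y @ [b]) \<in> T \<longleftrightarrow> Word (y @ [c]) \<in> T"
  unfolding finite_binary_tree_def by (cases b; cases c) auto

lemma finite_binary_treeI:
  assumes "finite T" "Root \<in> T" "Word [] \<in> T"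
    and parent: "\<And>y b. Word (y @ [b]) \<in> T \<Longrightarrow> Word y \<in> T"
    and "\<And>y. Word (y @ [False]) \<in> T \<longleftrightarrow> Word (y @ [True]) \<in> T"
  shows "finite_binary_tree T"
proof -
  have "Word u \<in> T" if "Word (u @ z) \<in> T" for u z
    using that
  proof (induction z rule: rev_induct)
    case (snoc b z)
    then show ?case using parent[of "u @ z" b] by simp
  qed simp
  then show ?thesis using assms(1-3,5) by (auto simp: finite_binary_tree_def prefix_def)
qed

lemma internal_Word:
  assumes "finite_binary_tree T"
  shows "Word y \<in> internal T \<longleftrightarrow> Word (y @ [b]) \<in> T"
  using finite_binary_tree_parent[OF assms, of y] finite_binary_tree_sibling[OF assms, of y]
  by (auto simp: internal_def leaves_def)

lemma Root_notin_internal: "Root \<notin> internal T"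
  by (auto simp: internal_def)

lemma rot_suffix_snoc: "s \<noteq> [] \<Longrightarrow> s \<noteq> [False] \<Longrightarrow> rot_suffix (s @ [b]) = rot_suffix s @ [b]"
  by (induction s rule: rot_suffix.induct) auto

lemma unrot_suffix_snoc: "s \<noteq> [] \<Longrightarrow> s \<noteq> [True] \<Longrightarrow> unrot_suffix (s @ [b]) = unrot_suffix s @ [b]"
  by (induction s rule: unrot_suffix.induct) auto

text \<open>
  A rotation need not commute with taking children: it changes the parent relation at the pivots
  and just above them. All words concerned, however, belong to the tree as soon as both pivots are
  internal, and so membership of children is transported even there.
\<close>

lemma preimage_word_snoc_mem:
  assumes T: "finite_binary_tree T" and "applies v T"
  shows "Word (preimage_word v (y @ [b])) \<in> T \<longleftrightarrow> Word (preimage_word v y @ [b]) \<in> T"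
proof -
  note child = internal_Word[OF T] and parent = finite_binary_tree_parent[OF T]
  show ?thesis
  proof (cases v)
    case (Rt u)
    with assms(2) have u: "Word (u @ [c]) \<in> T" and u0: "Word (u @ [False, c]) \<in> T" for c
      using child[of u c] child[of "u @ [False]" c] by (simp_all add: applies_def)
    show ?thesis
    proof (cases "prefix u y")
      case True
      then obtain s where y: "y = u @ s" by (auto simp: prefix_def)
      consider "s = []" | "s = [True]" | "s \<noteq> []" "s \<noteq> [True]" by blast
      then show ?thesis
        using y Rt u u0 parent[OF u]
        by cases (cases b; simp add: unrot_suffix_snoc)+
    next
      case False
      then show ?thesis using Rt u u0 parent[OF u] by auto
    qed
  next
    case (Lt u)
    with assms(2) have u: "Word (u @ [c]) \<in> T" and u1: "Word (u @ [True, c]) \<in> T" for c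
      using child[of u c] child[of "u @ [True]" c] by (simp_all add: applies_def)
    show ?thesis
    proof (cases "prefix u y")
      case True
      then obtain s where y: "y = u @ s" by (auto simp: prefix_def)
      consider "s = []" | "s = [False]" | "s \<noteq> []" "s \<noteq> [False]" by blast
      then show ?thesis
        using y Lt u u1 parent[OF u]
        by cases (cases b; simp add: rot_suffix_snoc)+
    next
      case False
      then show ?thesis using Lt u u1 parent[OF u] by auto
    qed
  qed
qed

lemma finite_binary_tree_rotate_tree:
  assumes T: "finite_binary_tree T" and v: "applies v T"
  shows "finite_binary_tree (rotate_tree v T)"
proof (rule finite_binary_treeI)
  note mem = mem_rotate_tree inv_rotation_Word inv_rotation_Root
  show "finite (rotate_tree v T)" "Root \<in> rotate_tree v T"
    using T by (simp_all add: finite_binary_tree_def mem_rotate_tree inv_rotation_Root)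
      (simp add: rotate_tree_def)
  have "Word (preimage_word v []) \<in> T"
    using T v internal_Word[OF T, of "[]" False]
    by (cases v) (auto simp: applies_def internal_def finite_binary_tree_def)
  then show "Word [] \<in> rotate_tree v T" by (simp add: mem)
  show "Word y \<in> rotate_tree v T" if "Word (y @ [b]) \<in> rotate_tree v T" for y b
    using that finite_binary_tree_parent[OF T] preimage_word_snoc_mem[OF assms] by (auto simp: mem)
  show "Word (y @ [False]) \<in> rotate_tree v T \<longleftrightarrow> Word (y @ [True]) \<in> rotate_tree v T" for y
    using finite_binary_tree_sibling[OF T] preimage_word_snoc_mem[OF assms] by (auto simp: mem)
qed

lemma internal_rotate_tree:
  assumes T: "finite_binary_tree T" and v: "applies v T"
  shows "x \<in> internal (rotate_tree v T) \<longleftrightarrow> inv (rotation v) x \<in> internal T"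
proof (cases x)
  case Root
  then show ?thesis by (simp add: Root_notin_internal inv_rotation_Root)
next
  case (Word y)
  then show ?thesis
    using preimage_word_snoc_mem[OF assms, of y False]
      internal_Word[OF T, of "preimage_word v y" False]
      internal_Word[OF finite_binary_tree_rotate_tree[OF assms], of y False]
    by (simp add: mem_rotate_tree inv_rotation_Word)
qed

section \<open>Extending a path by one rotation\<close>

text \<open>
  Paths and validity are defined by recursion on the first rotation, but the signed graph grows
  at the last one. The following equations recast everything in terms of the last rotation.
\<close>

lemma word_perm_snoc: "word_perm (w @ [v]) x = rotation v (word_perm w x)"
  by (induction w arbitrary: x) auto

lemma edge_path_snoc:
  "edge_path T (w @ [v]) \<longleftrightarrow> edge_path T w \<and> applies v (fold rotate_tree w T)"
  by (induction w arbitrary: T) auto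

lemma valid_path_snoc:
  "valid_path T \<sigma> (w @ [v]) \<longleftrightarrow> valid_path T \<sigma> w \<and>
     valid_rotation v (fold rotate_tree w T) (fold rotate_signs w \<sigma>)"
  by (induction w arbitrary: T \<sigma>) auto

lemma Sigma_upto_snoc: "i \<le> length w \<Longrightarrow> Sigma_upto (w @ [v]) i = Sigma_upto w i"
  by (induction i) (auto simp: Let_def nth_append)

definition pulled_pivot1 :: "symbol list \<Rightarrow> symbol \<Rightarrow> vertex" where
  "pulled_pivot1 w v = inv (word_perm w) (pivot1 v)"

definition pulled_pivot2 :: "symbol list \<Rightarrow> symbol \<Rightarrow> vertex" where
  "pulled_pivot2 w v = inv (word_perm w) (pivot2 v)"

lemma word_perm_pulled_pivot [simp]:
  "word_perm w (pulled_pivot1 w v) = pivot1 v"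
  "word_perm w (pulled_pivot2 w v) = pivot2 v"
  by (simp_all add: pulled_pivot1_def pulled_pivot2_def bij_word_perm bij_is_surj surj_f_inv_f)

lemma word_perm_eq_iff [simp]: "word_perm w x = word_perm w y \<longleftrightarrow> x = y"
  by (simp add: bij_word_perm bij_is_inj inj_eq)

lemma pulled_pivots_distinct: "pulled_pivot1 w v \<noteq> pulled_pivot2 w v"
proof
  assume "pulled_pivot1 w v = pulled_pivot2 w v"
  from arg_cong[OF this, of "word_perm w"] have "pivot1 v = pivot2 v"
    by (simp only: word_perm_pulled_pivot)
  with pivots_distinct show False by blast
qed

lemma Sigma_graph_snoc:
  "Sigma_graph (w @ [v]) = Sigma_graph w @
     [SEdge (pulled_pivot1 w v) (pulled_pivot2 w v)
       (even (degree (Sigma_graph w) (pulled_pivot1 w v) +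
              degree (Sigma_graph w) (pulled_pivot2 w v)))]"
  by (simp add: Sigma_graph_def Sigma_upto_snoc Let_def pulled_pivot1_def pulled_pivot2_def)

lemma degree_snoc:
  "degree (G @ [SEdge s t b]) x = degree G x + of_bool (s = x) + of_bool (t = x)"
  by (simp add: degree_def)

lemma internal_after_path:
  assumes "finite_binary_tree D" and "edge_path D w"
  shows "finite_binary_tree (fold rotate_tree w D) \<and>
    (\<forall>x. word_perm w x \<in> internal (fold rotate_tree w D) \<longleftrightarrow> x \<in> internal D)"
  using assms(2)
proof (induction w rule: rev_induct)
  case Nil
  then show ?case using assms(1) by simp
next
  case (snoc v w)
  then show ?case
    by (simp add: edge_path_snoc finite_binary_tree_rotate_tree internal_rotate_tree
        word_perm_snoc)
qed

lemma pulled_pivots_internal: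
  assumes "finite_binary_tree D" and "edge_path D (w @ [v])"
  shows "pulled_pivot1 w v \<in> internal D \<and> pulled_pivot2 w v \<in> internal D"
proof -
  from assms(2) have "edge_path D w" and "applies v (fold rotate_tree w D)"
    by (simp_all add: edge_path_snoc)
  with internal_after_path[OF assms(1), of w] show ?thesis
    by (simp add: applies_def del: word_perm_pulled_pivot
        flip: word_perm_pulled_pivot[of w v])
qed

theorem Sigma_graph_ends_internal:
  assumes "finite_binary_tree D" and "edge_path D w"
  shows "\<forall>e \<in> set (Sigma_graph w). end1 e \<in> internal D \<and> end2 e \<in> internal D"
  using assms(2)
proof (induction w rule: rev_induct)
  case Nil
  then show ?case by (simp add: Sigma_graph_def)
next
  case (snoc v w)
  then show ?case
    using pulled_pivots_internal[OF assms(1), of w v]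
    by (auto simp: Sigma_graph_snoc edge_path_snoc)
qed

section \<open>Validity of a path in terms of its signed graph\<close>

lemma neg_neg [simp]: "neg (neg a) = a"
  by (cases a) auto

lemma rotate_signs_rotation:
  "rotate_signs v \<sigma> (rotation v x) =
     (if x = pivot1 v \<or> x = pivot2 v then map_option neg (\<sigma> x) else \<sigma> x)"
  by (simp add: rotate_signs_def)

text \<open>
  A rotation flips the signs of its pivots; in the graph, the pulled-back pivots are the ends of
  the new edge. They are distinct, so the new edge raises the degree by one exactly at the two
  vertices whose sign is flipped.
\<close>

lemma signs_after_path:
  "fold rotate_signs w \<sigma> (word_perm w x) =
     (if even (degree (Sigma_graph w) x) then \<sigma> x else map_option neg (\<sigma> x))"
proof (induction w arbitrary: x rule: rev_induct)
  case Nil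
  then show ?case by (simp add: Sigma_graph_def degree_def)
next
  case (snoc v w)
  have pivot: "word_perm w x = pivot1 v \<longleftrightarrow> pulled_pivot1 w v = x"
    "word_perm w x = pivot2 v \<longleftrightarrow> pulled_pivot2 w v = x"
    by (auto simp del: word_perm_pulled_pivot simp flip: word_perm_pulled_pivot[of w v])
  have "map_option neg (map_option neg (\<sigma> x)) = \<sigma> x"
    by (cases "\<sigma> x") auto
  then show ?case
    using pulled_pivots_distinct[of w v]
    by (auto simp: word_perm_snoc rotate_signs_rotation pivot snoc.IH Sigma_graph_snoc degree_snoc)
qed

theorem valid_path_iff_consistent:
  assumes "finite_binary_tree D" and "sign_assignment D \<sigma>" and "edge_path D w"
  shows "valid_path D \<sigma> w \<longleftrightarrow> consistent \<sigma> (Sigma_graph w)"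
  using assms(3)
proof (induction w rule: rev_induct)
  case Nil
  then show ?case by (simp add: Sigma_graph_def consistent_def)
next
  case (snoc v w)
  define s t where "s = pulled_pivot1 w v" and "t = pulled_pivot2 w v"
  define G where "G = Sigma_graph w"
  \<comment> \<open>Both signs must be defined, because \<open>map_option neg\<close> leaves \<open>None\<close> unchanged.\<close>
  obtain a b where ab: "\<sigma> s = Some a" "\<sigma> t = Some b"
    using pulled_pivots_internal[OF assms(1) snoc.prems] assms(2)
    unfolding sign_assignment_def s_def t_def by blast
  have "fold rotate_signs w \<sigma> (pivot1 v) = fold rotate_signs w \<sigma> (pivot2 v) \<longleftrightarrow>
      fold rotate_signs w \<sigma> (word_perm w s) = fold rotate_signs w \<sigma> (word_perm w t)"
    by (simp add: s_def t_def)
  also have "\<dots> \<longleftrightarrow> (\<sigma> s = \<sigma> t \<longleftrightarrow> even (degree G s + degree G t))"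
    by (cases a; cases b) (simp_all add: signs_after_path ab G_def)
  finally have "valid_rotation v (fold rotate_tree w D) (fold rotate_signs w \<sigma>) \<longleftrightarrow>
      (\<sigma> s = \<sigma> t \<longleftrightarrow> even (degree G s + degree G t))"
    using snoc.prems by (simp add: valid_rotation_def edge_path_snoc)
  with snoc show ?case
    by (auto simp: valid_path_snoc edge_path_snoc consistent_def Sigma_graph_snoc s_def t_def G_def)
qed

theorem theorem11p1:
  fixes d :: nat and D :: "vertex set" and w :: "symbol list"
  assumes "D \<in> associahedron_vertices d"
    and "edge_path D w"
  shows "(\<forall>e \<in> set (Sigma_graph w). end1 e \<in> internal D \<and> end2 e \<in> internal D) \<and>
    ((\<exists>\<sigma>. sign_assignment D \<sigma> \<and> valid_path D \<sigma> w) \<longleftrightarrow> balanced (Sigma_graph w))"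
proof -
  let ?G = "Sigma_graph w"
  have D: "finite_binary_tree D"
    using assms(1) by (simp add: associahedron_vertices_def)
  note ends = Sigma_graph_ends_internal[OF D assms(2)]
  have "(\<exists>\<sigma>. sign_assignment D \<sigma> \<and> valid_path D \<sigma> w) \<longleftrightarrow>
      (\<exists>\<sigma>. sign_assignment D \<sigma> \<and> consistent \<sigma> ?G)"
    using valid_path_iff_consistent[OF D _ assms(2)] by blast
  also have "\<dots> \<longleftrightarrow> (\<exists>f :: vertex \<Rightarrow> bool. consistent f ?G)"
  proof
    assume "\<exists>\<sigma>. sign_assignment D \<sigma> \<and> consistent \<sigma> ?G"
    then obtain \<sigma> :: "vertex \<rightharpoonup> sign" where \<sigma>: "dom \<sigma> = internal D" "consistent \<sigma> ?G"
      by (auto simp: sign_assignment_def)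
    have "(\<sigma> x = Some Plus \<longleftrightarrow> \<sigma> y = Some Plus) \<longleftrightarrow> \<sigma> x = \<sigma> y"
      if "x \<in> internal D" "y \<in> internal D" for x y
    proof -
      from that \<sigma>(1) obtain a b where "\<sigma> x = Some a" "\<sigma> y = Some b" by blast
      then show ?thesis by (cases a; cases b) auto
    qed
    then have "consistent (\<lambda>x. \<sigma> x = Some Plus) ?G"
      using \<sigma>(2) ends by (simp add: consistent_def)
    then show "\<exists>f :: vertex \<Rightarrow> bool. consistent f ?G" by blast
  next
    assume "\<exists>f :: vertex \<Rightarrow> bool. consistent f ?G"
    then obtain f :: "vertex \<Rightarrow> bool" where f: "consistent f ?G" by blast
    let ?\<sigma> = "\<lambda>x. if x \<in> internal D then Some (if f x then Plus else Minus) else None"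
    have "sign_assignment D ?\<sigma>"
      by (auto simp: sign_assignment_def split: if_splits)
    moreover have "consistent ?\<sigma> ?G"
      using f ends by (auto simp: consistent_def)
    ultimately show "\<exists>\<sigma>. sign_assignment D \<sigma> \<and> consistent \<sigma> ?G" by blast
  qed
  also have "\<dots> \<longleftrightarrow> balanced ?G"
    by (simp add: balanced_iff_consistent)
  finally show ?thesis using ends by blast
qed

end
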